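(* Let $V$ be a real vector space of dimension $3$ with an inner product $\langle\cdot,\cdot\rangle$, let $\mathcal{B}$ be an orthonormal basis of $V$, and orient $V$ so that $\mathcal{B}$ is positively oriented. Let $u\in V$ be a unit vector with coordinates $(a,b,c)^t$ with respect to $\mathcal{B}$ (so $a^2+b^2+c^2=1$), let $E=\mathbb{R}u$ be the line generated by $u$, let $E^{\perp}$ be its orthogonal complement, and let $\alpha\in[0,2\pi)$. Put $$A=\begin{pmatrix} a^2&ab&ac\\ ab&b^2&bc\\ ac&bc&c^2\end{pmatrix},\qquad B=\begin{pmatrix} 0&-c&b\\ c&0&-a\\ -b&a&0\end{pmatrix},$$ and let $I$ be the $3\times 3$ identity matrix. Then the matrix with respect to $\mathcal{B}$ of the rotation $r_{E,\alpha}$ around the axis $E$ (directed by $u$) through the angle $\alpha$ in the positive sense is $$R=I+(\sin\alpha)B+(\cos\alpha-1)(I-A)\in M_3(\mathbb{Q}(a,b,c,\cos\alpha,\sin\alpha)),$$ and the matrix with respect to $\mathcal{B}$ of the orthogonal symmetry (reflection) $s_{E^{\perp}}$ on the plane $E^{\perp}$ is $$S=I-2A\in M_3(\mathbb{Q}(a,b,c)).$$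
   Context: Coordinates of vectors are written as columns. $\mathbb{Q}(a,b,c)$ and $\mathbb{Q}(a,b,c,\cos\alpha,\sin\alpha)$ denote the subfields of $\mathbb{R}$ generated by the indicated numbers, and $M_3(F)$ is the set of $3\times3$ matrices with entries in $F$. The vector product $\wedge$ on $V$ is the usual one for the given inner product and orientation (the standard cross product in $\mathcal{B}$-coordinates). The rotation $r_{E,\alpha}$ around the axis $E$ directed by $u$, of amplitude $\alpha$ and positive sense, is the linear map $V\to V$ with $r_{E,\alpha}(u)=u$ and, for every unit vector $v$ perpendicular to $u$, $r_{E,\alpha}(v)=(\cos\alpha)v+(\sin\alpha)(u\wedge v)$ and $r_{E,\alpha}(u\wedge v)=-(\sin\alpha)v+(\cos\alpha)(u\wedge v)$. The symmetry $s_{E^{\perp}}$ is the linear map $V\to V$ that sends $u$ to $-u$ and fixes every vector of $E^{\perp}$. *)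

theory Defs
  imports "HOL-Analysis.Analysis" "HOL-Algebra.Generated_Fields"
    "HOL-Algebra.Algebraic_Closure_Type"
begin

definition orthonormal_basis :: "(3 \<Rightarrow> 'v::real_inner) \<Rightarrow> bool" where
  "orthonormal_basis e \<longleftrightarrow>
     (\<forall>i j. e i \<bullet> e j = (if i = j then 1 else 0)) \<and> span (range e) = UNIV"

definition coords :: "(3 \<Rightarrow> 'v::real_inner) \<Rightarrow> 'v \<Rightarrow> real^3" where
  "coords e v = (\<chi> i. representation (range e) v (e i))"

definition of_coords :: "(3 \<Rightarrow> 'v::real_inner) \<Rightarrow> real^3 \<Rightarrow> 'v" where
  "of_coords e x = (\<Sum>i\<in>UNIV. x $ i *\<^sub>R e i)"

definition matrix_wrt :: "(3 \<Rightarrow> 'v::real_inner) \<Rightarrow> ('v \<Rightarrow> 'v) \<Rightarrow> real^3^3" where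
  "matrix_wrt e f = (\<chi> i j. coords e (f (e j)) $ i)"

text \<open>The vector product for the orientation in which the orthonormal basis \<open>e\<close> is positive.\<close>
definition vec_prod :: "(3 \<Rightarrow> 'v::real_inner) \<Rightarrow> 'v \<Rightarrow> 'v \<Rightarrow> 'v" where
  "vec_prod e x y = of_coords e (cross3 (coords e x) (coords e y))"

definition is_rotation :: "(3 \<Rightarrow> 'v::real_inner) \<Rightarrow> 'v \<Rightarrow> real \<Rightarrow> ('v \<Rightarrow> 'v) \<Rightarrow> bool" where
  "is_rotation e u \<alpha> r \<longleftrightarrow> linear r \<and> r u = u \<and>
     (\<forall>v. norm v = 1 \<and> orthogonal u v \<longrightarrow>
        r v = cos \<alpha> *\<^sub>R v + sin \<alpha> *\<^sub>R vec_prod e u v \<and>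
        r (vec_prod e u v) = - sin \<alpha> *\<^sub>R v + cos \<alpha> *\<^sub>R vec_prod e u v)"

definition is_reflection :: "'v::real_inner \<Rightarrow> ('v \<Rightarrow> 'v) \<Rightarrow> bool" where
  "is_reflection u s \<longleftrightarrow> linear s \<and> s u = - u \<and> (\<forall>v\<in>orthogonal_comp (span {u}). s v = v)"

text \<open>The descriptions below are proper for unit \<open>u\<close>: see \<open>ex1_rotation\<close> and \<open>ex1_reflection\<close>.\<close>
definition rotation :: "(3 \<Rightarrow> 'v::real_inner) \<Rightarrow> 'v \<Rightarrow> real \<Rightarrow> 'v \<Rightarrow> 'v" where
  "rotation e u \<alpha> = (THE r. is_rotation e u \<alpha> r)"

definition reflection :: "'v::real_inner \<Rightarrow> 'v \<Rightarrow> 'v" where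
  "reflection u = (THE s. is_reflection u s)"

text \<open>Every subfield of the reals contains the rationals, so the field generated by \<open>H\<close> is the
  extension of the rationals by \<open>H\<close>.\<close>
definition rat_adjoin :: "real set \<Rightarrow> real set" where
  "rat_adjoin H = generate_field (ring_of_type_algebra :: real ring) H"

definition mat3_over :: "real set \<Rightarrow> (real^3^3) set" where
  "mat3_over F = {M. \<forall>i j. M $ i $ j \<in> F}"

lemma orthonormal_basis_inj: "orthonormal_basis e \<Longrightarrow> inj e"
  unfolding orthonormal_basis_def inj_def by (metis zero_neq_one)

lemma orthonormal_basis_independent:
  assumes "orthonormal_basis e" shows "independent (range e)"
proof (rule pairwise_orthogonal_independent)
  show "pairwise orthogonal (range e)"
    using assms by (auto simp: orthonormal_basis_def pairwise_def orthogonal_def)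
  show "0 \<notin> range e"
    using assms unfolding orthonormal_basis_def by (metis imageE inner_zero_left zero_neq_one)
qed

lemma of_coords_coords:
  assumes "orthonormal_basis e" shows "of_coords e (coords e v) = v"
proof -
  have "(\<Sum>b\<in>range e. representation (range e) v b *\<^sub>R b) = v"
    using assms orthonormal_basis_independent[OF assms]
    by (intro sum_representation_eq) (auto simp: orthonormal_basis_def)
  then show ?thesis
    using orthonormal_basis_inj[OF assms] by (simp add: of_coords_def coords_def sum.reindex)
qed

lemma inner_of_coords:
  assumes "orthonormal_basis e" shows "of_coords e x \<bullet> of_coords e y = x \<bullet> y"
  using assms
  by (simp add: of_coords_def inner_sum_left inner_sum_right orthonormal_basis_def inner_vec_def
      if_distrib[of "\<lambda>t. _ * t"] mult.commute cong: if_cong)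

lemma inner_coords:
  assumes "orthonormal_basis e" shows "coords e x \<bullet> coords e y = x \<bullet> y"
  using inner_of_coords[OF assms, of "coords e x" "coords e y"] of_coords_coords[OF assms] by simp

lemma linear_of_coords: "linear (of_coords e)"
  by (rule linearI) (simp_all add: of_coords_def algebra_simps sum.distrib scaleR_sum_right)

lemma linear_coords:
  assumes "orthonormal_basis e" shows "linear (coords e)"
  using assms orthonormal_basis_independent[OF assms]
  by (intro linearI)
    (simp_all add: coords_def vec_eq_iff representation_add representation_scale orthonormal_basis_def)

lemma coords_of_coords:
  assumes "orthonormal_basis e" shows "coords e (of_coords e x) = x"
proof -
  have "of_coords e (coords e (of_coords e x) - x) = 0"
    by (simp add: linear_diff[OF linear_of_coords] of_coords_coords[OF assms])
  then have "(coords e (of_coords e x) - x) \<bullet> (coords e (of_coords e x) - x) = 0"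
    by (metis inner_of_coords[OF assms] inner_zero_left)
  then show ?thesis by simp
qed

lemma linear_vec_prod:
  assumes "orthonormal_basis e" shows "linear (vec_prod e u)"
  by (rule linearI)
    (simp_all add: vec_prod_def linear_add[OF linear_coords[OF assms]] cross_add_right cross_mult_right
      linear_cmul[OF linear_coords[OF assms]] linear_add[OF linear_of_coords] linear_cmul[OF linear_of_coords])

lemma ex1_rotation:
  assumes e: "orthonormal_basis e" and u: "norm u = 1"
  shows "\<exists>!r. is_rotation e u \<alpha> r"
proof -
  define r where "r x = (u \<bullet> x) *\<^sub>R u + cos \<alpha> *\<^sub>R (x - (u \<bullet> x) *\<^sub>R u) + sin \<alpha> *\<^sub>R vec_prod e u x" for x
  note lin = linear_vec_prod[OF e, of u]
  have uu: "u \<bullet> u = 1" using u by (simp add: norm_eq_1)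
  have pu: "vec_prod e u u = 0"
    by (simp add: vec_prod_def linear_0[OF linear_of_coords])
  have pp: "vec_prod e u (vec_prod e u v) = (u \<bullet> v) *\<^sub>R u - v" for v
    by (simp add: vec_prod_def coords_of_coords[OF e] Lagrange inner_coords[OF e] uu
        linear_diff[OF linear_of_coords] linear_cmul[OF linear_of_coords] of_coords_coords[OF e])
  have up: "u \<bullet> vec_prod e u v = 0" for v
  proof -
    have "u \<bullet> vec_prod e u v = coords e u \<bullet> cross3 (coords e u) (coords e v)"
      unfolding vec_prod_def by (subst inner_coords[OF e, symmetric]) (simp add: coords_of_coords[OF e])
    then show ?thesis by (simp add: dot_cross_self)
  qed
  have "linear r"
    by (rule linearI) (simp_all add: r_def linear_add[OF lin] linear_cmul[OF lin] algebra_simps)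
  then have "is_rotation e u \<alpha> r"
    by (simp add: is_rotation_def r_def uu pu up pp orthogonal_def)
  moreover have "f = r" if f: "is_rotation e u \<alpha> f" for f
  proof
    fix x
    have lf: "linear f" and fu: "f u = u" using f by (auto simp: is_rotation_def)
    define w where "w = x - (u \<bullet> x) *\<^sub>R u"
    have uw: "u \<bullet> w = 0" by (simp add: w_def inner_diff_right uu)
    have fw: "f w = cos \<alpha> *\<^sub>R w + sin \<alpha> *\<^sub>R vec_prod e u w"
    proof (cases "w = 0")
      case True
      then show ?thesis by (simp add: linear_0[OF lf] linear_0[OF lin])
    next
      case False
      define v where "v = (1 / norm w) *\<^sub>R w"
      have wv: "w = norm w *\<^sub>R v" using False by (simp add: v_def)
      have "norm v = 1" "orthogonal u v" using False uw by (auto simp: v_def orthogonal_def)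
      then have "f v = cos \<alpha> *\<^sub>R v + sin \<alpha> *\<^sub>R vec_prod e u v"
        using f by (simp add: is_rotation_def)
      then show ?thesis
        by (subst (1 2 3) wv) (simp add: linear_cmul[OF lf] linear_cmul[OF lin] algebra_simps)
    qed
    have x: "x = (u \<bullet> x) *\<^sub>R u + w" by (simp add: w_def)
    have "f x = (u \<bullet> x) *\<^sub>R u + f w"
      by (subst x) (simp only: linear_add[OF lf] linear_cmul[OF lf] fu)
    also have "\<dots> = r x"
      by (simp add: fw) (simp add: w_def r_def linear_diff[OF lin] linear_cmul[OF lin] pu)
    finally show "f x = r x" .
  qed
  ultimately show ?thesis by blast
qed

lemma ex1_reflection:
  fixes u :: "'v::real_inner"
  assumes u: "norm u = 1"
  shows "\<exists>!s. is_reflection u s"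
proof -
  define s where "s x = x - (2 * (u \<bullet> x)) *\<^sub>R u" for x
  have uu: "u \<bullet> u = 1" using u by (simp add: norm_eq_1)
  have perp: "v \<in> orthogonal_comp (span {u}) \<longleftrightarrow> u \<bullet> v = 0" for v
    by (auto simp: orthogonal_comp_def span_singleton orthogonal_def)
  have "linear s"
    by (rule linearI) (simp_all add: s_def algebra_simps)
  then have "is_reflection u s"
    by (simp add: is_reflection_def perp s_def uu) (simp add: scaleR_2)
  moreover have "f = s" if f: "is_reflection u f" for f
  proof
    fix x
    have lf: "linear f" and fu: "f u = - u" using f by (auto simp: is_reflection_def)
    define w where "w = x - (u \<bullet> x) *\<^sub>R u"
    have "f w = w"
      using f by (simp add: is_reflection_def perp w_def inner_diff_right uu)
    moreover have x: "x = (u \<bullet> x) *\<^sub>R u + w" by (simp add: w_def)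
    ultimately have "f x = - ((u \<bullet> x) *\<^sub>R u) + w"
      by (metis linear_add[OF lf] linear_cmul[OF lf] fu scaleR_minus_right)
    then show "f x = s x" by (simp add: w_def s_def scaleR_2[symmetric] algebra_simps)
  qed
  ultimately show ?thesis by blast
qed

end

theory Submission
  imports Defs
begin

text \<open>
  Expanding a vector \<open>x\<close> along \<open>u\<close> and its complement as \<open>x = (u \<bullet> x) u + w\<close> turns the
  defining properties of the two maps into closed vector formulas, the first being Rodrigues'
  formula:
  \<open>r x = x + sin \<alpha> (u \<and> x) + (cos \<alpha> - 1) (x - (u \<bullet> x) u)\<close> and \<open>s x = x - 2 (u \<bullet> x) u\<close>.
  A map is determined by its description, so it remains to check that the formulas satisfy the
  descriptions (\<open>rotation_eq\<close>, \<open>reflection_eq\<close>).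

  In orthonormal coordinates, \<open>x \<mapsto> (u \<bullet> x) u\<close> has matrix \<open>A = u u\<^sup>t\<close> and \<open>x \<mapsto> u \<and> x\<close> has the
  skew matrix \<open>B\<close> of the cross product, so \<open>R\<close> and \<open>S\<close> are read off from the formulas. Their entries
  are polynomials with integer coefficients in the generators, hence lie in the stated fields.
\<close>

section \<open>Vector formulas for the rotation and the reflection\<close>

lemma vec_prod_self: "vec_prod e u u = 0"
  by (simp add: vec_prod_def linear_0[OF linear_of_coords])

lemma inner_vec_prod_self:
  assumes "orthonormal_basis e"
  shows "u \<bullet> vec_prod e u v = 0"
proof -
  have "u \<bullet> vec_prod e u v = coords e u \<bullet> cross3 (coords e u) (coords e v)"
    unfolding vec_prod_def
    by (subst inner_coords[OF assms, symmetric]) (simp add: coords_of_coords[OF assms])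
  then show ?thesis by (simp add: dot_cross_self)
qed

text \<open>The Lagrange identity: on the complement of \<open>u\<close>, taking the product with \<open>u\<close> is a quarter turn.\<close>
lemma vec_prod_vec_prod:
  assumes "orthonormal_basis e" and "norm u = 1"
  shows "vec_prod e u (vec_prod e u v) = (u \<bullet> v) *\<^sub>R u - v"
  using assms(2)
  by (simp add: vec_prod_def coords_of_coords[OF assms(1)] Lagrange inner_coords[OF assms(1)] norm_eq_1
      linear_diff[OF linear_of_coords] linear_cmul[OF linear_of_coords] of_coords_coords[OF assms(1)])

lemma rotation_eq:
  assumes e: "orthonormal_basis e" and u: "norm u = 1"
  shows "rotation e u \<alpha> =
    (\<lambda>x. x + sin \<alpha> *\<^sub>R vec_prod e u x + (cos \<alpha> - 1) *\<^sub>R (x - (u \<bullet> x) *\<^sub>R u))"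
  unfolding rotation_def
proof (rule the1_equality[OF ex1_rotation[OF e u]])
  let ?r = "\<lambda>x. x + sin \<alpha> *\<^sub>R vec_prod e u x + (cos \<alpha> - 1) *\<^sub>R (x - (u \<bullet> x) *\<^sub>R u)"
  note lin = linear_vec_prod[OF e, of u]
  have "linear ?r"
    by (rule linearI) (simp_all add: linear_add[OF lin] linear_cmul[OF lin] algebra_simps)
  then show "is_rotation e u \<alpha> ?r"
    using u by (simp add: is_rotation_def vec_prod_self inner_vec_prod_self[OF e]
        vec_prod_vec_prod[OF e u] orthogonal_def norm_eq_1 algebra_simps)
qed

lemma reflection_eq:
  fixes u :: "'v::real_inner"
  assumes u: "norm u = 1"
  shows "reflection u = (\<lambda>x. x - 2 *\<^sub>R ((u \<bullet> x) *\<^sub>R u))"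
  unfolding reflection_def
proof (rule the1_equality[OF ex1_reflection[OF u]])
  let ?s = "\<lambda>x. x - 2 *\<^sub>R ((u \<bullet> x) *\<^sub>R u)"
  have "linear ?s"
    by (rule linearI) (simp_all add: algebra_simps)
  moreover have "?s u = - u"
    using u by (simp add: norm_eq_1 scaleR_2)
  moreover have "?s v = v" if "v \<in> orthogonal_comp (span {u})" for v
    using that span_base[of u "{u}"] by (simp add: orthogonal_comp_def orthogonal_def)
  ultimately show "is_reflection u ?s"
    by (simp add: is_reflection_def)
qed

section \<open>Matrices with respect to an orthonormal basis\<close>

lemma coords_basis:
  assumes "orthonormal_basis e"
  shows "coords e (e j) = axis j 1"
  using orthonormal_basis_inj[OF assms] orthonormal_basis_independent[OF assms]
  by (auto simp: coords_def vec_eq_iff representation_basis axis_def inj_eq)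

lemma matrix_wrt_eqI:
  assumes "orthonormal_basis e" and "\<And>x. coords e (f x) = M *v coords e x"
  shows "matrix_wrt e f = M"
  by (simp add: matrix_wrt_def assms(2) coords_basis[OF assms(1)] matrix_vector_mul_component
      inner_axis vec_eq_iff)

lemma outer_product_matrix_vector:
  fixes a b c :: real
  shows "(vector [vector [a^2, a*b, a*c], vector [a*b, b^2, b*c], vector [a*c, b*c, c^2]] :: real^3^3)
      *v x = (vector [a, b, c] \<bullet> x) *\<^sub>R vector [a, b, c]"
  by (simp add: vec_eq_iff forall_3 matrix_vector_mult_def inner_vec_def sum_3 power2_eq_square
      algebra_simps)

lemma cross_product_matrix_vector:
  fixes a b c :: real
  shows "(vector [vector [0, -c, b], vector [c, 0, -a], vector [-b, a, 0]] :: real^3^3) *v x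
      = cross3 (vector [a, b, c]) x"
  by (simp add: vec_eq_iff forall_3 matrix_vector_mult_def cross3_def sum_3)

section \<open>The field generated over the rationals\<close>

lemma rat_adjoin_generator: "x \<in> H \<Longrightarrow> x \<in> rat_adjoin H"
  unfolding rat_adjoin_def by (rule generate_field.incl)

lemma rat_adjoin_1: "1 \<in> rat_adjoin H"
  using generate_field.one[of "ring_of_type_algebra :: real ring" H]
  by (simp add: rat_adjoin_def ring_of_type_algebra_def)

lemma rat_adjoin_add: "x \<in> rat_adjoin H \<Longrightarrow> y \<in> rat_adjoin H \<Longrightarrow> x + y \<in> rat_adjoin H"
  using generate_field.eng_add[of x "ring_of_type_algebra :: real ring" H y]
  by (simp add: rat_adjoin_def ring_of_type_algebra_def)

lemma rat_adjoin_mult: "x \<in> rat_adjoin H \<Longrightarrow> y \<in> rat_adjoin H \<Longrightarrow> x * y \<in> rat_adjoin H"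
  using generate_field.eng_mult[of x "ring_of_type_algebra :: real ring" H y]
  by (simp add: rat_adjoin_def ring_of_type_algebra_def)

text \<open>The negative in a ring record is a choice in its group of units, so it is identified with the
  negative of the reals by uniqueness of additive inverses.\<close>
lemma rat_adjoin_uminus:
  assumes "x \<in> rat_adjoin H"
  shows "- x \<in> rat_adjoin H"
proof -
  let ?R = "ring_of_type_algebra :: real ring"
  interpret R: Ring.field ?R by rule
  have "\<ominus>\<^bsub>?R\<^esub> x = - x"
    by (rule R.minus_equality) (simp_all add: ring_of_type_algebra_def)
  then show ?thesis
    using assms generate_field.a_inv[of x ?R H] by (simp add: rat_adjoin_def)
qed

lemma rat_adjoin_0: "0 \<in> rat_adjoin H"
  using rat_adjoin_add[OF rat_adjoin_1 rat_adjoin_uminus[OF rat_adjoin_1]] by simp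

lemma rat_adjoin_diff: "x \<in> rat_adjoin H \<Longrightarrow> y \<in> rat_adjoin H \<Longrightarrow> x - y \<in> rat_adjoin H"
  using rat_adjoin_add[OF _ rat_adjoin_uminus] by fastforce

lemma rat_adjoin_2: "2 \<in> rat_adjoin H"
  using rat_adjoin_add[OF rat_adjoin_1 rat_adjoin_1] by simp

lemmas rat_adjoin_intros =
  rat_adjoin_0 rat_adjoin_1 rat_adjoin_2 rat_adjoin_add rat_adjoin_mult rat_adjoin_uminus
  rat_adjoin_diff rat_adjoin_generator

section \<open>The matrices of the rotation and the reflection\<close>

theorem mainTheorem1:
  fixes e :: "3 \<Rightarrow> 'v::real_inner" and u :: 'v and a b c \<alpha> :: real
  assumes "dim (UNIV :: 'v set) = 3"
    and "orthonormal_basis e"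
    and "norm u = 1"
    and "coords e u = vector [a, b, c]"
    and "0 \<le> \<alpha>" and "\<alpha> < 2 * pi"
  shows "let
      A = vector [vector [a^2, a*b, a*c],
                  vector [a*b, b^2, b*c],
                  vector [a*c, b*c, c^2]] :: real^3^3;
      B = vector [vector [0, -c, b],
                  vector [c, 0, -a],
                  vector [-b, a, 0]] :: real^3^3;
      I = mat 1 :: real^3^3;
      R = I + sin \<alpha> *\<^sub>R B + (cos \<alpha> - 1) *\<^sub>R (I - A);
      S = I - 2 *\<^sub>R A
    in matrix_wrt e (rotation e u \<alpha>) = R
       \<and> R \<in> mat3_over (rat_adjoin {a, b, c, cos \<alpha>, sin \<alpha>})
       \<and> matrix_wrt e (reflection u) = S
       \<and> S \<in> mat3_over (rat_adjoin {a, b, c})"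
proof -
  note e = assms(2) and u = assms(3) and abc = assms(4)
  define A where "A = (vector [vector [a^2, a*b, a*c],
                  vector [a*b, b^2, b*c],
                  vector [a*c, b*c, c^2]] :: real^3^3)"
  define B where "B = (vector [vector [0, -c, b],
                  vector [c, 0, -a],
                  vector [-b, a, 0]] :: real^3^3)"
  define R where "R = mat 1 + sin \<alpha> *\<^sub>R B + (cos \<alpha> - 1) *\<^sub>R (mat 1 - A)"
  define S where "S = mat 1 - 2 *\<^sub>R A"
  note lin = linear_add[OF linear_coords[OF e]] linear_diff[OF linear_coords[OF e]]
    linear_cmul[OF linear_coords[OF e]]
  have Ax: "A *v coords e x = (u \<bullet> x) *\<^sub>R coords e u" for x
    by (simp add: A_def outer_product_matrix_vector abc[symmetric] inner_coords[OF e])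
  have Bx: "B *v coords e x = coords e (vec_prod e u x)" for x
    by (simp add: B_def cross_product_matrix_vector abc[symmetric] vec_prod_def coords_of_coords[OF e])
  have "matrix_wrt e (rotation e u \<alpha>) = R"
    by (rule matrix_wrt_eqI[OF e])
      (simp add: rotation_eq[OF e u] R_def lin Ax Bx matrix_vector_mult_add_rdistrib
        matrix_vector_mult_diff_rdistrib scaleR_matrix_vector_assoc[symmetric])
  moreover have "matrix_wrt e (reflection u) = S"
    by (rule matrix_wrt_eqI[OF e])
      (simp add: reflection_eq[OF u] S_def lin Ax
        matrix_vector_mult_diff_rdistrib scaleR_matrix_vector_assoc[symmetric])
  moreover have "R \<in> mat3_over (rat_adjoin {a, b, c, cos \<alpha>, sin \<alpha>})"
    by (simp add: mat3_over_def R_def A_def B_def forall_3 mat_def power2_eq_square rat_adjoin_intros)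
  moreover have "S \<in> mat3_over (rat_adjoin {a, b, c})"
    by (simp add: mat3_over_def S_def A_def forall_3 mat_def power2_eq_square rat_adjoin_intros)
  ultimately show ?thesis
    unfolding Let_def A_def B_def R_def S_def by blast
qed

end
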